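(* Let $\mathcal{R}$ be a commutative ring with identity, let $(X,\leqslant)$ be a locally finite pre-ordered set, and let $D:I(X,\mathcal{R})\to I(X,\mathcal{R})$ be an $\mathcal{R}$-linear operator, with coefficients $C^{ij}_{xy}$ defined by $D(e_{ij})=\sum_{x\leqslant y}C^{ij}_{xy}e_{xy}$. Then $D$ is a derivation if and only if $$D(e_{ij})=\sum_{x\in L_i}C^{ii}_{xi}e_{xj}+C^{ij}_{ij}e_{ij}+\sum_{y\in R_j}C^{jj}_{jy}e_{iy}$$ for all $i,j\in X$ with $i\leqslant j$, where the coefficients satisfy the relations $$C^{jj}_{jk}+C^{kk}_{jk}=0\quad\text{if } j\leqslant k,$$ $$C^{ij}_{ij}+C^{jk}_{jk}=C^{ik}_{ik}\quad\text{if } i\leqslant j,\ j\leqslant k.$$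
   Context: A pre-ordered set $(X,\leqslant)$ is a set with a reflexive and transitive binary relation $\leqslant$; it is locally finite if for all $x\leqslant y$ in $X$ there are only finitely many $z\in X$ with $x\leqslant z\leqslant y$. The incidence algebra $I(X,\mathcal{R})$ is the $\mathcal{R}$-algebra of all functions $f:X\times X\to\mathcal{R}$ with $f(x,y)=0$ whenever $x\not\leqslant y$, with pointwise addition and scalar multiplication and with product (convolution) $(fg)(x,y)=\sum_{x\leqslant z\leqslant y}f(x,z)g(z,y)$ (for $x\leqslant y$). A derivation is an $\mathcal{R}$-linear mapping $D:I(X,\mathcal{R})\to I(X,\mathcal{R})$ with $D(fg)=D(f)g+fD(g)$ for all $f,g$. For $x\leqslant y$ in $X$, $e_{xy}\in I(X,\mathcal{R})$ is the function with $e_{xy}(x,y)=1$ and $e_{xy}(u,v)=0$ for $(u,v)\neq(x,y)$. A (possibly infinite) sum $\sum_{x\leqslant y}c_{xy}e_{xy}$ denotes the element of $I(X,\mathcal{R})$ whose value at $(x,y)$ is $c_{xy}$ for $x\leqslant y$; thus $C^{ij}_{xy}=D(e_{ij})(x,y)$ for $i\leqslant j$, $x\leqslant y$. For $x\in X$: $L_x=\{i\in X\mid i\leqslant x,\ i\neq x\}$ and $R_x=\{j\in X\mid x\leqslant j,\ j\neq x\}$.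
   Formalization: For the "if" direction, D is also assumed to satisfy D(f) = Σ f(i,j) D(e_ij) as a pointwise finite sum; without this the claim fails for infinite X. The condition is shown to hold for every derivation, and for every linear D if X is finite. *)

theory Defs
  imports "HOL-Library.Function_Algebras"
begin

text \<open>
  A pre-ordered set is a carrier \<open>X\<close> with a relation \<open>r \<subseteq> X \<times> X\<close>, where \<open>(x, y) \<in> r\<close> stands for
  \<open>x \<le> y\<close>. Addition of functions is the pointwise one of \<open>Function_Algebras\<close>; the pointwise
  multiplication of that theory is never used, the product is \<open>conv\<close> below.
\<close>

definition locally_finite_preorder :: "'x set \<Rightarrow> 'x rel \<Rightarrow> bool" where
  "locally_finite_preorder X r \<longleftrightarrow>
     preorder_on X r \<and> (\<forall>(x, y)\<in>r. finite {z \<in> X. (x, z) \<in> r \<and> (z, y) \<in> r})"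

text \<open>
  Functions on \<open>X \<times> X\<close> are extended by zero to the whole type: as \<open>r \<subseteq> X \<times> X\<close>, the condition
  below covers both \<open>\<not> x \<le> y\<close> within \<open>X\<close> and arguments outside \<open>X\<close>.
\<close>

definition incidence_algebra :: "'x rel \<Rightarrow> ('x \<Rightarrow> 'x \<Rightarrow> 'r::comm_ring_1) set" where
  "incidence_algebra r = {f. \<forall>x y. (x, y) \<notin> r \<longrightarrow> f x y = 0}"

definition scale :: "'r \<Rightarrow> ('x \<Rightarrow> 'x \<Rightarrow> 'r) \<Rightarrow> 'x \<Rightarrow> 'x \<Rightarrow> 'r::comm_ring_1" where
  "scale c f = (\<lambda>x y. c * f x y)"

definition conv ::
    "'x rel \<Rightarrow> ('x \<Rightarrow> 'x \<Rightarrow> 'r) \<Rightarrow> ('x \<Rightarrow> 'x \<Rightarrow> 'r) \<Rightarrow> 'x \<Rightarrow> 'x \<Rightarrow> 'r::comm_ring_1" where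
  "conv r f g = (\<lambda>x y. if (x, y) \<in> r
     then \<Sum>z | (x, z) \<in> r \<and> (z, y) \<in> r. f x z * g z y else 0)"

definition mat_unit :: "'x \<Rightarrow> 'x \<Rightarrow> 'x \<Rightarrow> 'x \<Rightarrow> 'r::comm_ring_1" where
  "mat_unit x y = (\<lambda>u v. if u = x \<and> v = y then 1 else 0)"

definition linear_operator ::
    "'x rel \<Rightarrow> (('x \<Rightarrow> 'x \<Rightarrow> 'r::comm_ring_1) \<Rightarrow> ('x \<Rightarrow> 'x \<Rightarrow> 'r)) \<Rightarrow> bool" where
  "linear_operator r D \<longleftrightarrow>
     (\<forall>f\<in>incidence_algebra r. D f \<in> incidence_algebra r) \<and>
     (\<forall>f\<in>incidence_algebra r. \<forall>g\<in>incidence_algebra r. D (f + g) = D f + D g) \<and>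
     (\<forall>c. \<forall>f\<in>incidence_algebra r. D (scale c f) = scale c (D f))"

definition derivation ::
    "'x rel \<Rightarrow> (('x \<Rightarrow> 'x \<Rightarrow> 'r::comm_ring_1) \<Rightarrow> ('x \<Rightarrow> 'x \<Rightarrow> 'r)) \<Rightarrow> bool" where
  "derivation r D \<longleftrightarrow> linear_operator r D \<and>
     (\<forall>f\<in>incidence_algebra r. \<forall>g\<in>incidence_algebra r.
        D (conv r f g) = conv r (D f) g + conv r f (D g))"

text \<open>\<open>coeff D i j x y\<close> is the coefficient \<open>C\<close> with upper indices \<open>i j\<close> and lower indices \<open>x y\<close>.\<close>

definition coeff ::
    "(('x \<Rightarrow> 'x \<Rightarrow> 'r::comm_ring_1) \<Rightarrow> ('x \<Rightarrow> 'x \<Rightarrow> 'r)) \<Rightarrow> 'x \<Rightarrow> 'x \<Rightarrow> 'x \<Rightarrow> 'x \<Rightarrow> 'r" where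
  "coeff D i j x y = D (mat_unit i j) x y"

definition lower :: "'x rel \<Rightarrow> 'x \<Rightarrow> 'x set" where
  "lower r x = {i. (i, x) \<in> r \<and> i \<noteq> x}"

definition upper :: "'x rel \<Rightarrow> 'x \<Rightarrow> 'x set" where
  "upper r x = {j. (x, j) \<in> r \<and> j \<noteq> x}"

text \<open>
  A possibly infinite sum of functions is taken pointwise. It is meaningful for families that are
  pointwise finite, i.e. for which only finitely many members are nonzero at each argument.
\<close>

definition pointwise_finite :: "'k set \<Rightarrow> ('k \<Rightarrow> 'x \<Rightarrow> 'x \<Rightarrow> 'r::comm_ring_1) \<Rightarrow> bool" where
  "pointwise_finite K F \<longleftrightarrow> (\<forall>x y. finite {k \<in> K. F k x y \<noteq> 0})"

definition pointwise_sum ::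
    "'k set \<Rightarrow> ('k \<Rightarrow> 'x \<Rightarrow> 'x \<Rightarrow> 'r) \<Rightarrow> 'x \<Rightarrow> 'x \<Rightarrow> 'r::comm_ring_1" where
  "pointwise_sum K F = (\<lambda>x y. \<Sum>k\<in>{k \<in> K. F k x y \<noteq> 0}. F k x y)"

text \<open>The sum of all \<open>c x y * e x y\<close> with \<open>x \<le> y\<close> has the value \<open>c x y\<close> at \<open>(x, y) \<in> r\<close>.\<close>

lemma pointwise_sum_mat_unit:
  fixes c :: "'x \<Rightarrow> 'x \<Rightarrow> 'r::comm_ring_1"
  shows "pointwise_finite r (\<lambda>(x, y). scale (c x y) (mat_unit x y))"
    and "pointwise_sum r (\<lambda>(x, y). scale (c x y) (mat_unit x y))
       = (\<lambda>x y. if (x, y) \<in> r then c x y else 0)"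
proof -
  have supp: "{k \<in> r. (case k of (x, y) \<Rightarrow> scale (c x y) (mat_unit x y)) u v \<noteq> 0}
      = (if (u, v) \<in> r \<and> c u v \<noteq> 0 then {(u, v)} else {})" for u v
    by (auto simp: scale_def mat_unit_def split: if_splits)
  show "pointwise_finite r (\<lambda>(x, y). scale (c x y) (mat_unit x y))"
    unfolding pointwise_finite_def supp by simp
  show "pointwise_sum r (\<lambda>(x, y). scale (c x y) (mat_unit x y))
       = (\<lambda>x y. if (x, y) \<in> r then c x y else 0)"
    unfolding pointwise_sum_def supp by (auto simp: fun_eq_iff scale_def mat_unit_def)
qed

text \<open>
  \<open>D\<close> respects the expansion of \<open>f\<close> as the sum of all \<open>f i j * e i j\<close>. Linearity alone yields this
  only for finite sums; for infinite \<open>X\<close> a linear operator is not determined by its values on the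
  elements \<open>e i j\<close>.
\<close>

definition respects_sums ::
    "'x rel \<Rightarrow> (('x \<Rightarrow> 'x \<Rightarrow> 'r::comm_ring_1) \<Rightarrow> ('x \<Rightarrow> 'x \<Rightarrow> 'r)) \<Rightarrow> bool" where
  "respects_sums r D \<longleftrightarrow> (\<forall>f\<in>incidence_algebra r.
     pointwise_finite r (\<lambda>(i, j). scale (f i j) (D (mat_unit i j))) \<and>
     D f = pointwise_sum r (\<lambda>(i, j). scale (f i j) (D (mat_unit i j))))"

text \<open>On finite pre-ordered sets, every linear operator respects sums.\<close>

lemma finite_respects_sums:
  fixes D :: "('x \<Rightarrow> 'x \<Rightarrow> 'r::comm_ring_1) \<Rightarrow> ('x \<Rightarrow> 'x \<Rightarrow> 'r)"
  assumes fin: "finite r" and lin: "linear_operator r D"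
  shows "respects_sums r D"
proof -
  have D0: "D (\<lambda>x y. 0) = (\<lambda>x y. 0)"
  proof -
    have z: "scale 0 (\<lambda>x y. 0) = (\<lambda>x y. 0::'r)" "(\<lambda>x y. 0::'r) \<in> incidence_algebra r"
      by (auto simp: scale_def incidence_algebra_def)
    have "D (scale 0 (\<lambda>x y. 0)) = scale 0 (D (\<lambda>x y. 0))"
      using lin z(2) unfolding linear_operator_def by blast
    then show ?thesis by (simp add: z(1)) (simp add: scale_def)
  qed
  have step: "D (\<lambda>x y. if (x, y) \<in> S then f x y else 0)
      = (\<lambda>x y. \<Sum>(i, j)\<in>S. f i j * D (mat_unit i j) x y)" if "S \<subseteq> r" for S f
    using finite_subset[OF that fin] that
  proof (induction S rule: finite_induct)
    case empty
    then show ?case using D0 by simp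
  next
    case (insert p S)
    obtain i j where p: "p = (i, j)" by (cases p)
    let ?h = "\<lambda>x y. if (x, y) \<in> S then f x y else 0"
    have mem: "?h \<in> incidence_algebra r" "mat_unit i j \<in> incidence_algebra r"
      "scale (f i j) (mat_unit i j) \<in> incidence_algebra r"
      using insert.prems p by (auto simp: incidence_algebra_def mat_unit_def scale_def)
    have "(\<lambda>x y. if (x, y) \<in> insert p S then f x y else 0) = scale (f i j) (mat_unit i j) + ?h"
      using insert.hyps p by (auto simp: fun_eq_iff scale_def mat_unit_def)
    then have "D (\<lambda>x y. if (x, y) \<in> insert p S then f x y else 0)
        = D (scale (f i j) (mat_unit i j) + ?h)"
      by (rule arg_cong)
    also have "\<dots> = D (scale (f i j) (mat_unit i j)) + D ?h"
      using lin mem(1,3) unfolding linear_operator_def by blast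
    also have "D (scale (f i j) (mat_unit i j)) = scale (f i j) (D (mat_unit i j))"
      using lin mem(2) unfolding linear_operator_def by blast
    also have "D ?h = (\<lambda>x y. \<Sum>(i, j)\<in>S. f i j * D (mat_unit i j) x y)"
      using insert by simp
    finally show ?case using insert.hyps p by (simp add: fun_eq_iff scale_def)
  qed
  show ?thesis unfolding respects_sums_def
  proof (intro ballI conjI)
    fix f :: "'x \<Rightarrow> 'x \<Rightarrow> 'r" assume f: "f \<in> incidence_algebra r"
    show "pointwise_finite r (\<lambda>(i, j). scale (f i j) (D (mat_unit i j)))"
      using fin by (simp add: pointwise_finite_def)
    have "(\<lambda>x y. if (x, y) \<in> r then f x y else 0) = f"
      using f by (auto simp: incidence_algebra_def fun_eq_iff)
    then have "D f = (\<lambda>x y. \<Sum>(i, j)\<in>r. f i j * D (mat_unit i j) x y)"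
      using step[of r f] by simp
    also have "\<dots> = pointwise_sum r (\<lambda>(i, j). scale (f i j) (D (mat_unit i j)))"
      unfolding pointwise_sum_def
      by (intro ext sum.mono_neutral_cong_right) (auto simp: fin scale_def)
    finally show "D f = pointwise_sum r (\<lambda>(i, j). scale (f i j) (D (mat_unit i j)))" .
  qed
qed

end

theory Submission
  imports Defs
begin

text \<open>
  Write \<open>e i j\<close> for the matrix units. Derivations turn out to be exactly the operators
  \<open>f \<mapsto> m f - f m + s \<circ> f\<close>, the sum of an inner derivation and of entrywise multiplication by a
  function \<open>s\<close> with \<open>s x z + s z y = s x y\<close> for \<open>x \<le> z \<le> y\<close>. The coefficients of \<open>D\<close> tell which
  \<open>m\<close> and \<open>s\<close> to take: \<open>m x y\<close> is the entry of \<open>D (e y y)\<close> at \<open>(x, y)\<close>, and \<open>s x y\<close> is that of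
  \<open>D (e x y)\<close> at \<open>(x, y)\<close>.

  Two facts reduce the theorem to this normal form. If the two relations between coefficients
  hold, then the displayed formula for \<open>D (e i j)\<close> says precisely that \<open>D\<close> and the normal form
  agree on matrix units (\<open>ad_plus_schur_expansion\<close>). Moreover, the normal form always respects
  sums (\<open>ad_plus_schur_sums\<close>), because its value at \<open>(x, y)\<close> only involves entries of \<open>f\<close> in the
  row of \<open>x\<close> or the column of \<open>y\<close> with indices in the finite interval from \<open>x\<close> to \<open>y\<close>.

  Thus, if the formula and the relations hold and \<open>D\<close> respects sums, \<open>D\<close> equals the normal form
  everywhere, which satisfies the Leibniz rule by associativity and the additivity of \<open>s\<close>
  (\<open>ad_plus_schur_leibniz\<close>). Conversely, a derivation satisfies the relations by the Leibniz rule
  for products of matrix units, and applying it to \<open>e x x f e y y = f x y e x y\<close> and comparing the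
  entries at \<open>(x, y)\<close> yields the normal form for every \<open>f\<close>, not only for finite combinations of
  matrix units (\<open>derivation_eq_ad_plus_schur\<close>). So a derivation respects sums.
\<close>

section \<open>Convolution\<close>

definition interval :: "'x rel \<Rightarrow> 'x \<Rightarrow> 'x \<Rightarrow> 'x set" where
  "interval r x y = {z. (x, z) \<in> r \<and> (z, y) \<in> r}"

text \<open>
  Reflexivity is only asked for at points that are related to something, so that no carrier has to
  be mentioned. Finiteness of intervals can be asked for at all pairs, as the interval between
  unrelated points is empty by transitivity.
\<close>

locale loc_fin_preorder =
  fixes r :: "'x rel"
  assumes trans: "\<And>x y z. (x, y) \<in> r \<Longrightarrow> (y, z) \<in> r \<Longrightarrow> (x, z) \<in> r"
    and refl_left: "\<And>x y. (x, y) \<in> r \<Longrightarrow> (x, x) \<in> r"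
    and refl_right: "\<And>x y. (x, y) \<in> r \<Longrightarrow> (y, y) \<in> r"
    and finite_interval [simp]: "\<And>x y. finite (interval r x y)"

lemma loc_fin_preorderI:
  assumes "locally_finite_preorder X r"
  shows "loc_fin_preorder r"
proof
  have sub: "r \<subseteq> X \<times> X" and refl: "refl_on X r" and tr: "trans r"
    and fin: "\<And>x y. (x, y) \<in> r \<Longrightarrow> finite {z \<in> X. (x, z) \<in> r \<and> (z, y) \<in> r}"
    using assms unfolding locally_finite_preorder_def preorder_on_def by auto
  show t: "(x, z) \<in> r" if "(x, y) \<in> r" "(y, z) \<in> r" for x y z
    using tr that by (rule transD)
  show "(x, x) \<in> r" "(y, y) \<in> r" if "(x, y) \<in> r" for x y
    using that sub refl by (auto dest: refl_onD)
  show "finite (interval r x y)" for x y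
  proof (cases "(x, y) \<in> r")
    case True
    moreover have "interval r x y = {z \<in> X. (x, z) \<in> r \<and> (z, y) \<in> r}"
      using sub by (auto simp: interval_def)
    ultimately show ?thesis using fin by simp
  next
    case False
    then have "interval r x y = {}" using t by (auto simp: interval_def)
    then show ?thesis by simp
  qed
qed

lemma incidence_algebraD: "f \<in> incidence_algebra r \<Longrightarrow> (x, y) \<notin> r \<Longrightarrow> f x y = 0"
  by (simp add: incidence_algebra_def)

lemma mat_unit_mem [simp]: "(i, j) \<in> r \<Longrightarrow> mat_unit i j \<in> incidence_algebra r"
  by (auto simp: incidence_algebra_def mat_unit_def)

lemma conv_mem [simp]: "conv r f g \<in> incidence_algebra r"
  by (auto simp: incidence_algebra_def conv_def)

context loc_fin_preorder
begin

lemma conv_eq: "conv r f g x y = (\<Sum>z\<in>interval r x y. f x z * g z y)"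
proof (cases "(x, y) \<in> r")
  case False
  then have "interval r x y = {}" using trans by (auto simp: interval_def)
  with False show ?thesis by (simp add: conv_def)
qed (simp add: conv_def interval_def)

text \<open>
  Both bracketings are sums over the square of the interval from \<open>x\<close> to \<open>y\<close>, once the inner sums
  are extended by vanishing terms.
\<close>

lemma conv_assoc:
  assumes g: "g \<in> incidence_algebra r"
  shows "conv r (conv r f g) h = conv r f (conv r g h)"
proof (intro ext)
  fix x y
  let ?I = "interval r x y"
  have l: "conv r f g x z = (\<Sum>w\<in>?I. f x w * g w z)" if "z \<in> ?I" for z
    unfolding conv_eq using that trans incidence_algebraD[OF g]
    by (intro sum.mono_neutral_left finite_interval) (auto simp: interval_def)
  have r: "conv r g h w y = (\<Sum>z\<in>?I. g w z * h z y)" if "w \<in> ?I" for w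
    unfolding conv_eq using that trans incidence_algebraD[OF g]
    by (intro sum.mono_neutral_left finite_interval) (auto simp: interval_def, metis mult_zero_left)
  have "conv r (conv r f g) h x y = (\<Sum>z\<in>?I. \<Sum>w\<in>?I. f x w * g w z * h z y)"
    unfolding conv_eq[of "conv r f g"] by (simp add: l sum_distrib_right cong: sum.cong)
  also have "\<dots> = (\<Sum>w\<in>?I. \<Sum>z\<in>?I. f x w * (g w z * h z y))"
    by (subst sum.swap) (simp add: mult.assoc)
  also have "\<dots> = conv r f (conv r g h) x y"
    unfolding conv_eq[of f] by (simp add: r sum_distrib_left cong: sum.cong)
  finally show "conv r (conv r f g) h x y = conv r f (conv r g h) x y" .
qed

lemma conv_unit_left:
  assumes "(i, j) \<in> r" "g \<in> incidence_algebra r"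
  shows "conv r (mat_unit i j) g x y = (if x = i then g j y else 0)"
proof -
  have "conv r (mat_unit i j) g x y
      = (\<Sum>z\<in>interval r x y. if z = j then (if x = i then g j y else 0) else 0)"
    unfolding conv_eq by (intro sum.cong) (auto simp: mat_unit_def)
  also have "\<dots> = (if j \<in> interval r x y then (if x = i then g j y else 0) else 0)"
    by simp
  finally show ?thesis
    using assms by (auto simp: interval_def incidence_algebraD)
qed

lemma conv_unit_right:
  assumes "(i, j) \<in> r" "g \<in> incidence_algebra r"
  shows "conv r g (mat_unit i j) x y = (if y = j then g x i else 0)"
proof -
  have "conv r g (mat_unit i j) x y
      = (\<Sum>z\<in>interval r x y. if z = i then (if y = j then g x i else 0) else 0)"
    unfolding conv_eq by (intro sum.cong) (auto simp: mat_unit_def)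
  also have "\<dots> = (if i \<in> interval r x y then (if y = j then g x i else 0) else 0)"
    by simp
  finally show ?thesis
    using assms by (auto simp: interval_def incidence_algebraD)
qed

lemma conv_units:
  assumes "(i, j) \<in> r" "(k, l) \<in> r"
  shows "conv r (mat_unit i j) (mat_unit k l) = (if j = k then mat_unit i l else (\<lambda>x y. 0))"
  unfolding fun_eq_iff conv_unit_left[OF assms(1) mat_unit_mem[OF assms(2)]]
  by (auto simp: mat_unit_def)

end

section \<open>The normal form of derivations\<close>

text \<open>
  The commutator with \<open>m\<close> plus the Schur (entrywise) product with \<open>s\<close>.
\<close>

definition ad_plus_schur ::
    "'x rel \<Rightarrow> ('x \<Rightarrow> 'x \<Rightarrow> 'r) \<Rightarrow> ('x \<Rightarrow> 'x \<Rightarrow> 'r) \<Rightarrow>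
      ('x \<Rightarrow> 'x \<Rightarrow> 'r) \<Rightarrow> 'x \<Rightarrow> 'x \<Rightarrow> 'r::comm_ring_1" where
  "ad_plus_schur r m s f = (\<lambda>x y. conv r m f x y - conv r f m x y + s x y * f x y)"

context loc_fin_preorder
begin

text \<open>
  The commutator contributes \<open>(m f) g - f (g m) = (m f - f m) g + f (m g - g m)\<close>, and the
  entrywise multiplier splits over every intermediate point \<open>z\<close> as \<open>s x z + s z y\<close>.
\<close>

lemma ad_plus_schur_leibniz:
  assumes f: "f \<in> incidence_algebra r" and g: "g \<in> incidence_algebra r"
    and m: "m \<in> incidence_algebra r"
    and s: "\<And>x z y. (x, z) \<in> r \<Longrightarrow> (z, y) \<in> r \<Longrightarrow> s x z + s z y = s x y"
  shows "ad_plus_schur r m s (conv r f g)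
       = conv r (ad_plus_schur r m s f) g + conv r f (ad_plus_schur r m s g)"
proof (intro ext)
  fix x y
  let ?I = "interval r x y"
  have "conv r (ad_plus_schur r m s f) g x y
      = conv r (conv r m f) g x y - conv r (conv r f m) g x y
        + (\<Sum>z\<in>?I. s x z * f x z * g z y)"
    by (simp add: conv_eq[of _ g] ad_plus_schur_def algebra_simps sum.distrib sum_subtractf)
  moreover have "conv r f (ad_plus_schur r m s g) x y
      = conv r f (conv r m g) x y - conv r f (conv r g m) x y
        + (\<Sum>z\<in>?I. s z y * f x z * g z y)"
    by (simp add: conv_eq[of f] ad_plus_schur_def algebra_simps sum.distrib sum_subtractf)
  moreover have "s x y * conv r f g x y
      = (\<Sum>z\<in>?I. s x z * f x z * g z y) + (\<Sum>z\<in>?I. s z y * f x z * g z y)"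
    unfolding conv_eq sum_distrib_left sum.distrib[symmetric]
    by (intro sum.cong) (auto simp: interval_def s[symmetric] algebra_simps)
  moreover have "conv r (conv r m f) g = conv r m (conv r f g)"
    "conv r (conv r f m) g = conv r f (conv r m g)"
    "conv r f (conv r g m) = conv r (conv r f g) m"
    using f g m by (simp_all add: conv_assoc)
  ultimately show "ad_plus_schur r m s (conv r f g) x y
      = (conv r (ad_plus_schur r m s f) g + conv r f (ad_plus_schur r m s g)) x y"
    by (simp add: ad_plus_schur_def)
qed

lemma ad_plus_schur_unit:
  assumes "(i, j) \<in> r" "m \<in> incidence_algebra r"
  shows "ad_plus_schur r m s (mat_unit i j) x y
       = (if y = j then m x i else 0) - (if x = i then m j y else 0)
         + (if x = i \<and> y = j then s i j else 0)"
  unfolding ad_plus_schur_def conv_unit_left[OF assms] conv_unit_right[OF assms]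
  by (auto simp: mat_unit_def)

text \<open>
  At \<open>(x, y)\<close>, the matrix unit \<open>e i j\<close> contributes only if \<open>j = y\<close> or \<open>i = x\<close>, and then the other
  index lies in the interval from \<open>x\<close> to \<open>y\<close>. The sum over these two segments is the convolution
  of \<open>f\<close> with \<open>m\<close> on either side.
\<close>

lemma ad_plus_schur_sums:
  fixes f m s :: "'x \<Rightarrow> 'x \<Rightarrow> 'r::comm_ring_1"
  assumes f: "f \<in> incidence_algebra r" and m: "m \<in> incidence_algebra r"
  defines "F \<equiv> \<lambda>(i, j). scale (f i j) (ad_plus_schur r m s (mat_unit i j))"
  shows "pointwise_finite r F" and "pointwise_sum r F = ad_plus_schur r m s f"
proof -
  define T where "T x y = {p \<in> r. fst p \<in> interval r x y \<and> snd p = y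
    \<or> fst p = x \<and> snd p \<in> interval r x y \<or> p = (x, y)}" for x y
  \<comment> \<open>The contributions of \<open>p\<close> to \<open>m f\<close>, \<open>f m\<close> and the entrywise product with \<open>s\<close>, respectively.\<close>
  define a where "a x y p = (if snd p = y then f (fst p) y * m x (fst p) else 0)"
    for x y and p :: "'x \<times> 'x"
  define b where "b x y p = (if fst p = x then f x (snd p) * m (snd p) y else 0)"
    for x y and p :: "'x \<times> 'x"
  define c where "c x y p = (if p = (x, y) then s x y * f x y else 0)"
    for x y and p :: "'x \<times> 'x"
  have F: "F p x y = a x y p - b x y p + c x y p" if "p \<in> r" for p x y
    using that m by (cases p) (auto simp: F_def scale_def ad_plus_schur_unit a_def b_def c_def
      algebra_simps)
  have finT: "finite (T x y)" for x y
  proof (rule finite_subset)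
    show "T x y \<subseteq> interval r x y \<times> {y} \<union> {x} \<times> interval r x y \<union> {(x, y)}"
      by (auto simp: T_def)
  qed simp
  have supp: "{p \<in> r. F p x y \<noteq> 0} \<subseteq> T x y" for x y
  proof
    fix p assume p: "p \<in> {p \<in> r. F p x y \<noteq> 0}"
    obtain i j where ij: "p = (i, j)" by (cases p)
    have "a x y p \<noteq> 0 \<or> b x y p \<noteq> 0 \<or> c x y p \<noteq> 0" using p F[of p x y] by auto
    then show "p \<in> T x y"
      using p ij incidence_algebraD[OF m]
      by (auto simp: T_def interval_def a_def b_def c_def split: if_splits) (metis mult_zero_right)+
  qed
  show "pointwise_finite r F"
    unfolding pointwise_finite_def using finite_subset[OF supp finT] by blast
  show "pointwise_sum r F = ad_plus_schur r m s f"
  proof (intro ext)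
    fix x y
    have "pointwise_sum r F x y = (\<Sum>p\<in>T x y. F p x y)"
      unfolding pointwise_sum_def using supp finT
      by (intro sum.mono_neutral_left) (auto simp: T_def)
    also have "\<dots> = (\<Sum>p\<in>T x y. a x y p) - (\<Sum>p\<in>T x y. b x y p) + (\<Sum>p\<in>T x y. c x y p)"
      unfolding sum_subtractf[symmetric] sum.distrib[symmetric]
      by (intro sum.cong refl F) (simp add: T_def)
    also have "(\<Sum>p\<in>T x y. a x y p) = (\<Sum>p\<in>(\<lambda>z. (z, y)) ` interval r x y. a x y p)"
      using incidence_algebraD[OF m] incidence_algebraD[OF f] refl_left refl_right
      by (intro sum.mono_neutral_right finT) (auto simp: T_def interval_def a_def image_iff)
    also have "\<dots> = conv r m f x y"
      by (subst sum.reindex) (auto simp: inj_on_def conv_eq a_def mult.commute)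
    also have "(\<Sum>p\<in>T x y. b x y p) = (\<Sum>p\<in>(\<lambda>z. (x, z)) ` interval r x y. b x y p)"
      using incidence_algebraD[OF m] incidence_algebraD[OF f] refl_left refl_right
      by (intro sum.mono_neutral_right finT) (auto simp: T_def interval_def b_def image_iff)
    also have "\<dots> = conv r f m x y"
      by (subst sum.reindex) (auto simp: inj_on_def conv_eq b_def)
    also have "(\<Sum>p\<in>T x y. c x y p) = s x y * f x y"
      using finT incidence_algebraD[OF f] by (auto simp: c_def T_def)
    finally show "pointwise_sum r F x y = ad_plus_schur r m s f x y"
      by (simp add: ad_plus_schur_def)
  qed
qed

end

lemma pointwise_finite_cong:
  assumes "\<And>k. k \<in> K \<Longrightarrow> F k = G k"
  shows "pointwise_finite K F \<longleftrightarrow> pointwise_finite K G"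
proof -
  have "{k \<in> K. F k x y \<noteq> 0} = {k \<in> K. G k x y \<noteq> 0}" for x y
    using assms by auto
  then show ?thesis by (simp add: pointwise_finite_def)
qed

lemma pointwise_sum_cong:
  assumes "\<And>k. k \<in> K \<Longrightarrow> F k = G k"
  shows "pointwise_sum K F = pointwise_sum K G"
  unfolding pointwise_sum_def
  by (intro ext sum.cong) (use assms in auto)

lemma pointwise_sum_column:
  "pointwise_sum K (\<lambda>k. scale (c k) (mat_unit k j)) x y = (if x \<in> K \<and> y = j then c x else 0)"
proof -
  have "{k \<in> K. scale (c k) (mat_unit k j) x y \<noteq> 0}
      = (if x \<in> K \<and> y = j \<and> c x \<noteq> 0 then {x} else {})"
    by (auto simp: scale_def mat_unit_def split: if_splits)
  then show ?thesis by (auto simp: pointwise_sum_def scale_def mat_unit_def)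
qed

lemma pointwise_sum_row:
  "pointwise_sum K (\<lambda>k. scale (c k) (mat_unit i k)) x y = (if x = i \<and> y \<in> K then c y else 0)"
proof -
  have "{k \<in> K. scale (c k) (mat_unit i k) x y \<noteq> 0}
      = (if x = i \<and> y \<in> K \<and> c y \<noteq> 0 then {y} else {})"
    by (auto simp: scale_def mat_unit_def split: if_splits)
  then show ?thesis by (auto simp: pointwise_sum_def scale_def mat_unit_def)
qed

section \<open>The normal form read off from the coefficients\<close>

text \<open>
  For an operator \<open>D\<close> on the algebra the case distinction matters only if \<open>(y, y) \<notin> r\<close>: then
  \<open>mat_unit y y\<close> is outside the algebra and the value of \<open>D\<close> there is arbitrary.
\<close>

definition inner_part ::
    "'x rel \<Rightarrow> (('x \<Rightarrow> 'x \<Rightarrow> 'r::comm_ring_1) \<Rightarrow> ('x \<Rightarrow> 'x \<Rightarrow> 'r)) \<Rightarrow> 'x \<Rightarrow> 'x \<Rightarrow> 'r" where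
  "inner_part r D = (\<lambda>x y. if (x, y) \<in> r then coeff D y y x y else 0)"

definition schur_part ::
    "(('x \<Rightarrow> 'x \<Rightarrow> 'r::comm_ring_1) \<Rightarrow> ('x \<Rightarrow> 'x \<Rightarrow> 'r)) \<Rightarrow> 'x \<Rightarrow> 'x \<Rightarrow> 'r" where
  "schur_part D = (\<lambda>x y. coeff D x y x y)"

lemma inner_part_mem [simp]: "inner_part r D \<in> incidence_algebra r"
  by (simp add: incidence_algebra_def inner_part_def)

lemma linear_operator_scale:
  assumes "linear_operator r D" "f \<in> incidence_algebra r"
  shows "D (scale c f) = scale c (D f)"
  using assms by (auto simp: linear_operator_def)

lemma linear_operator_zero:
  assumes "linear_operator r D"
  shows "D (\<lambda>x y. 0) = (\<lambda>x y. 0)"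
  using linear_operator_scale[OF assms, of "\<lambda>x y. 0" 0]
  by (simp add: incidence_algebra_def scale_def)

lemma additive_coeff_diag_eq_0:
  assumes "\<And>i j k. (i, j) \<in> r \<Longrightarrow> (j, k) \<in> r \<Longrightarrow>
    coeff D i j i j + coeff D j k j k = coeff D i k i k"
    and "(i, i) \<in> r"
  shows "coeff D i i i i = 0"
  using assms(1)[OF assms(2) assms(2)] by simp

context loc_fin_preorder
begin

text \<open>
  Let \<open>m\<close> be the inner part. The first sum of the formula is \<open>m e i j\<close>, as its missing term
  \<open>x = i\<close> is zero by \<open>add\<close>. The last sum is \<open>- e i j m\<close>, because \<open>skew\<close> turns \<open>coeff D j j j y\<close>
  into \<open>- coeff D y y j y\<close>, the missing term \<open>y = j\<close> being zero again.
\<close>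

lemma ad_plus_schur_expansion:
  assumes skew: "\<And>j k. (j, k) \<in> r \<Longrightarrow> coeff D j j j k + coeff D k k j k = 0"
    and add: "\<And>i j k. (i, j) \<in> r \<Longrightarrow> (j, k) \<in> r \<Longrightarrow>
      coeff D i j i j + coeff D j k j k = coeff D i k i k"
    and ij: "(i, j) \<in> r"
  shows "pointwise_sum (lower r i) (\<lambda>x. scale (coeff D i i x i) (mat_unit x j))
             + scale (coeff D i j i j) (mat_unit i j)
             + pointwise_sum (upper r j) (\<lambda>y. scale (coeff D j j j y) (mat_unit i y))
       = ad_plus_schur r (inner_part r D) (schur_part D) (mat_unit i j)" (is "?L = ?R")
proof (intro ext)
  fix u v
  have diag: "coeff D i i i i = 0" "coeff D j j j j = 0"
    using additive_coeff_diag_eq_0[OF add] refl_left[OF ij] refl_right[OF ij] by blast+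
  have sk: "coeff D j j j v = - coeff D v v j v" if "(j, v) \<in> r"
    using skew[OF that] by (simp add: eq_neg_iff_add_eq_0)
  have "?L u v = (if u \<in> lower r i \<and> v = j then coeff D i i u i else 0)
      + (if u = i \<and> v = j then coeff D i j i j else 0)
      + (if u = i \<and> v \<in> upper r j then coeff D j j j v else 0)"
    by (simp only: plus_fun_apply pointwise_sum_column pointwise_sum_row)
      (simp add: scale_def mat_unit_def)
  also have "\<dots> = ?R u v"
    unfolding ad_plus_schur_unit[OF ij inner_part_mem] using diag sk refl_left[OF ij]
    by (auto simp: inner_part_def schur_part_def lower_def upper_def)
  finally show "?L u v = ?R u v" .
qed

lemma ad_plus_schur_imp_respects_sums:
  assumes "m \<in> incidence_algebra r"
    and D: "\<And>f. f \<in> incidence_algebra r \<Longrightarrow> D f = ad_plus_schur r m s f"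
  shows "respects_sums r D"
proof -
  have "pointwise_finite r (\<lambda>(i, j). scale (f i j) (D (mat_unit i j)))
      \<longleftrightarrow> pointwise_finite r (\<lambda>(i, j). scale (f i j) (ad_plus_schur r m s (mat_unit i j)))" for f
    by (rule pointwise_finite_cong) (auto simp: D)
  moreover have "pointwise_sum r (\<lambda>(i, j). scale (f i j) (D (mat_unit i j)))
      = pointwise_sum r (\<lambda>(i, j). scale (f i j) (ad_plus_schur r m s (mat_unit i j)))" for f
    by (rule pointwise_sum_cong) (auto simp: D)
  ultimately show ?thesis
    unfolding respects_sums_def using ad_plus_schur_sums[OF _ assms(1)] D by simp
qed

lemma respects_sums_imp_ad_plus_schur:
  assumes m: "m \<in> incidence_algebra r"
    and sums: "respects_sums r D"
    and D: "\<And>i j. (i, j) \<in> r \<Longrightarrow> D (mat_unit i j) = ad_plus_schur r m s (mat_unit i j)"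
    and f: "f \<in> incidence_algebra r"
  shows "D f = ad_plus_schur r m s f"
proof -
  have "D f = pointwise_sum r (\<lambda>(i, j). scale (f i j) (D (mat_unit i j)))"
    using sums f by (simp add: respects_sums_def)
  also have "\<dots> = pointwise_sum r (\<lambda>(i, j). scale (f i j) (ad_plus_schur r m s (mat_unit i j)))"
    by (rule pointwise_sum_cong) (auto simp: D)
  also have "\<dots> = ad_plus_schur r m s f"
    using f m by (rule ad_plus_schur_sums)
  finally show ?thesis .
qed

section \<open>Derivations have the normal form\<close>

lemma derivation_conv:
  assumes "derivation r D" "f \<in> incidence_algebra r" "g \<in> incidence_algebra r"
  shows "D (conv r f g) x y = conv r (D f) g x y + conv r f (D g) x y"
  using assms by (simp add: derivation_def)

lemma derivation_mem:
  assumes "derivation r D" "f \<in> incidence_algebra r"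
  shows "D f \<in> incidence_algebra r"
  using assms by (simp add: derivation_def linear_operator_def)

text \<open>The Leibniz rule for \<open>e i j e j k = e i k\<close>, at \<open>(i, k)\<close>.\<close>

lemma derivation_coeff_add:
  fixes D :: "('x \<Rightarrow> 'x \<Rightarrow> 'r::comm_ring_1) \<Rightarrow> ('x \<Rightarrow> 'x \<Rightarrow> 'r)"
  assumes D: "derivation r D" and ij: "(i, j) \<in> r" and jk: "(j, k) \<in> r"
  shows "coeff D i j i j + coeff D j k j k = coeff D i k i k"
proof -
  have "conv r (mat_unit i j) (mat_unit j k) = (mat_unit i k :: 'x \<Rightarrow> 'x \<Rightarrow> 'r)"
    using ij jk by (simp add: conv_units)
  then show ?thesis
    using derivation_conv[OF D mat_unit_mem[OF ij] mat_unit_mem[OF jk], of i k] ij jk D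
    by (simp add: conv_unit_left conv_unit_right derivation_mem coeff_def)
qed

text \<open>The Leibniz rule for \<open>e j j e k k = 0\<close>, at \<open>(j, k)\<close>.\<close>

lemma derivation_coeff_skew:
  fixes D :: "('x \<Rightarrow> 'x \<Rightarrow> 'r::comm_ring_1) \<Rightarrow> ('x \<Rightarrow> 'x \<Rightarrow> 'r)"
  assumes D: "derivation r D" and jk: "(j, k) \<in> r"
  shows "coeff D j j j k + coeff D k k j k = 0"
proof (cases "j = k")
  case True
  then show ?thesis
    using additive_coeff_diag_eq_0[OF derivation_coeff_add[OF D]] jk by auto
next
  case False
  have jj: "(j, j) \<in> r" and kk: "(k, k) \<in> r"
    using jk refl_left refl_right by blast+
  have "conv r (mat_unit j j) (mat_unit k k) = ((\<lambda>x y. 0) :: 'x \<Rightarrow> 'x \<Rightarrow> 'r)"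
    using jj kk False by (simp add: conv_units)
  moreover have "D (\<lambda>x y. 0) = (\<lambda>x y. 0)"
    using D linear_operator_zero by (auto simp: derivation_def)
  ultimately show ?thesis
    using derivation_conv[OF D mat_unit_mem[OF jj] mat_unit_mem[OF kk], of j k] jj kk D
    by (simp add: conv_unit_left conv_unit_right derivation_mem coeff_def)
qed

text \<open>
  The entry of \<open>D (e x x f e y y)\<close> at \<open>(x, y)\<close> is \<open>f x y\<close> times that of \<open>D (e x y)\<close>. By the
  Leibniz rule it is also the sum of the entries there of \<open>D (e x x) f\<close>, \<open>D f\<close> and \<open>f D (e y y)\<close>.
  The first is the entry of \<open>- m f\<close> by the relation \<open>derivation_coeff_skew\<close>, and the last is the
  entry of \<open>f m\<close> by the definition of \<open>m\<close>.
\<close>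

lemma derivation_eq_ad_plus_schur:
  assumes D: "derivation r D" and f: "f \<in> incidence_algebra r"
  shows "D f = ad_plus_schur r (inner_part r D) (schur_part D) f"
proof (intro ext)
  fix x y
  let ?m = "inner_part r D"
  show "D f x y = ad_plus_schur r ?m (schur_part D) f x y"
  proof (cases "(x, y) \<in> r")
    case False
    then show ?thesis
      using derivation_mem[OF D f] f by (simp add: incidence_algebra_def ad_plus_schur_def conv_def)
  next
    case True
    then have xx: "(x, x) \<in> r" and yy: "(y, y) \<in> r"
      using refl_left refl_right by blast+
    have lin: "linear_operator r D" using D by (simp add: derivation_def)
    let ?ef = "conv r (mat_unit x x) f"
    have "conv r ?ef (mat_unit y y) = scale (f x y) (mat_unit x y)"
      using xx yy f by (simp add: fun_eq_iff conv_unit_left conv_unit_right)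
        (auto simp: scale_def mat_unit_def)
    then have "D (conv r ?ef (mat_unit y y)) x y = schur_part D x y * f x y"
      using linear_operator_scale[OF lin mat_unit_mem[OF True]]
      by (simp add: scale_def schur_part_def coeff_def)
    moreover have "D (conv r ?ef (mat_unit y y)) x y
        = conv r (D ?ef) (mat_unit y y) x y + conv r ?ef (D (mat_unit y y)) x y"
      using yy by (intro derivation_conv[OF D]) simp_all
    moreover have "conv r (D ?ef) (mat_unit y y) x y = D ?ef x y"
      using yy derivation_mem[OF D] by (simp add: conv_unit_right)
    moreover have "D ?ef x y = conv r (D (mat_unit x x)) f x y + conv r (mat_unit x x) (D f) x y"
      using xx f by (intro derivation_conv[OF D]) simp_all
    moreover have "conv r (mat_unit x x) (D f) x y = D f x y"
      using xx derivation_mem[OF D f] by (simp add: conv_unit_left)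
    moreover have "conv r (D (mat_unit x x)) f x y = - conv r ?m f x y"
      unfolding conv_eq sum_negf[symmetric]
    proof (intro sum.cong refl)
      fix z assume "z \<in> interval r x y"
      then have xz: "(x, z) \<in> r" by (simp add: interval_def)
      then have "D (mat_unit x x) x z = - ?m x z"
        using derivation_coeff_skew[OF D xz]
        by (simp add: inner_part_def coeff_def eq_neg_iff_add_eq_0)
      then show "D (mat_unit x x) x z * f z y = - (?m x z * f z y)" by simp
    qed
    moreover have "conv r ?ef (D (mat_unit y y)) x y = conv r f ?m x y"
      unfolding conv_eq[of ?ef] conv_eq[of f] using xx f
      by (intro sum.cong) (auto simp: conv_unit_left inner_part_def coeff_def interval_def)
    ultimately show ?thesis by (simp add: ad_plus_schur_def algebra_simps)
  qed
qed

lemma ad_plus_schur_imp_derivation: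
  assumes "linear_operator r D"
    and "\<And>f. f \<in> incidence_algebra r \<Longrightarrow> D f = ad_plus_schur r m s f"
    and "m \<in> incidence_algebra r"
    and "\<And>x z y. (x, z) \<in> r \<Longrightarrow> (z, y) \<in> r \<Longrightarrow> s x z + s z y = s x y"
  shows "derivation r D"
  using assms by (simp add: derivation_def ad_plus_schur_leibniz)

end

section \<open>Characterization of derivations by their coefficients\<close>

theorem theorem2p2:
  fixes X :: "'x set" and r :: "'x rel"
    and D :: "('x \<Rightarrow> 'x \<Rightarrow> 'r::comm_ring_1) \<Rightarrow> ('x \<Rightarrow> 'x \<Rightarrow> 'r)"
  assumes "locally_finite_preorder X r" and "linear_operator r D"
  shows "(respects_sums r D \<longrightarrow>
      (derivation r D \<longleftrightarrow>
        (\<forall>i j. (i, j) \<in> r \<longrightarrow>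
           D (mat_unit i j) =
             pointwise_sum (lower r i) (\<lambda>x. scale (coeff D i i x i) (mat_unit x j))
             + scale (coeff D i j i j) (mat_unit i j)
             + pointwise_sum (upper r j) (\<lambda>y. scale (coeff D j j j y) (mat_unit i y))) \<and>
        (\<forall>j k. (j, k) \<in> r \<longrightarrow> coeff D j j j k + coeff D k k j k = 0) \<and>
        (\<forall>i j k. (i, j) \<in> r \<and> (j, k) \<in> r \<longrightarrow>
           coeff D i j i j + coeff D j k j k = coeff D i k i k))) \<and>
    (derivation r D \<longrightarrow> respects_sums r D)"
proof -
  interpret loc_fin_preorder r
    using assms(1) by (rule loc_fin_preorderI)
  let ?N = "ad_plus_schur r (inner_part r D) (schur_part D)"
  show ?thesis (is "(_ \<longrightarrow> (_ \<longleftrightarrow> ?expansion \<and> ?skew \<and> ?add)) \<and> _")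
  proof (intro conjI impI iffI)
    assume der: "derivation r D"
    show "respects_sums r D"
      using inner_part_mem derivation_eq_ad_plus_schur[OF der]
      by (rule ad_plus_schur_imp_respects_sums)
    have skew: "coeff D j j j k + coeff D k k j k = 0" if "(j, k) \<in> r" for j k
      using der that by (rule derivation_coeff_skew)
    have add: "coeff D i j i j + coeff D j k j k = coeff D i k i k"
      if "(i, j) \<in> r" "(j, k) \<in> r" for i j k
      using der that by (rule derivation_coeff_add)
    show ?skew ?add using skew add by blast+
    show ?expansion
      using ad_plus_schur_expansion[OF skew add] derivation_eq_ad_plus_schur[OF der]
      by simp
  next
    assume sums: "respects_sums r D" and coeffs: "?expansion \<and> ?skew \<and> ?add"
    have skew: "coeff D j j j k + coeff D k k j k = 0" if "(j, k) \<in> r" for j k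
      using coeffs that by blast
    have add: "coeff D i j i j + coeff D j k j k = coeff D i k i k"
      if "(i, j) \<in> r" "(j, k) \<in> r" for i j k
      using coeffs that by blast
    have unit: "D (mat_unit i j) = ?N (mat_unit i j)" if "(i, j) \<in> r" for i j
      using coeffs that ad_plus_schur_expansion[OF skew add that] by simp
    show "derivation r D"
      using assms(2) respects_sums_imp_ad_plus_schur[OF inner_part_mem sums unit] inner_part_mem
      by (rule ad_plus_schur_imp_derivation) (use add in \<open>simp_all add: schur_part_def\<close>)
  qed
qed

end
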